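(* Let $\mathcal X,\mathcal Y$ be finite-dimensional Euclidean spaces, let $\mathcal C\subseteq\mathcal X$ be a nonempty closed convex set with $0\notin\mathcal C$, and let $A:\mathcal X\to\mathcal Y$ be a linear map with adjoint $A^*$. Then $$(A\mathcal C)'=(A^* )^{-1}\mathcal C'.$$ Furthermore, if $\operatorname{cl}(A\mathcal C)$ does not contain the origin, then both sets above are nonempty.
   Context: The antipolar of a set $\mathcal D$ is $\mathcal D'=\{y\mid\langle y,x\rangle\ge1\ \forall x\in\mathcal D\}$. $A\mathcal C$ is the image of $\mathcal C$ under $A$, and $(A^* )^{-1}\mathcal C'$ is the preimage of $\mathcal C'$ under $A^*$. $\operatorname{cl}$ denotes closure. *)

theory Defs
  imports "HOL-Analysis.Analysis"
begin

definition antipolar :: "'a::real_inner set \<Rightarrow> 'a set" where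
  "antipolar D = {y. \<forall>x\<in>D. inner y x \<ge> 1}"

text \<open>
  Types of class \<open>euclidean_space\<close> have dimension at least 1. A space that may be the zero
  space is therefore represented by a \<open>real_inner\<close> type satisfying the predicate below. (A space with a
  nonempty subset avoiding 0 is nonzero, so for such a space the class loses nothing.)
\<close>

definition finite_dim_space :: "'a::real_vector itself \<Rightarrow> bool" where
  "finite_dim_space _ \<longleftrightarrow> (\<exists>B::'a set. finite B \<and> span B = UNIV)"

end

(* Nonemptiness reduces to separating the origin from M C, where M = A* A acts on the Euclidean
   source space: if w is at least 1 on M C, then A w is at least 1 on A C. The origin stays away
   from M C because the norms of A x and M x are comparable: M is bounded below on the orthogonal
   complement of ker A, and both norms depend only on the component of x there. *)
theory Submission
  imports Defs
begin

text \<open>The library has these facts only when the codomain is of class \<open>euclidean_space\<close> too.\<close>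

lemma adjoint_works_real_inner:
  fixes f :: "'a::euclidean_space \<Rightarrow> 'b::real_inner"
  assumes "linear f"
  shows "inner x (adjoint f y) = inner (f x) y"
proof -
  interpret f: linear f by fact
  \<comment> \<open>\<open>adjoint\<close> is defined by choice, so an actual adjoint must be
    exhibited first. Its coordinates are forced by the basis vectors of the source; uniqueness then
    identifies it with \<open>adjoint f\<close>.\<close>
  let ?g = "\<lambda>y. \<Sum>i\<in>Basis. inner (f i) y *\<^sub>R i"
  have rep: "\<forall>x y. inner (f x) y = inner x (?g y)"
  proof (intro allI)
    fix x y
    have "inner (f x) y = inner (f (\<Sum>i\<in>Basis. inner x i *\<^sub>R i)) y"
      by (simp add: euclidean_representation)
    also have "\<dots> = inner (\<Sum>i\<in>Basis. inner x i *\<^sub>R f i) y"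
      by (simp add: f.sum f.scale)
    finally show "inner (f x) y = inner x (?g y)"
      by (simp add: inner_sum_left inner_sum_right mult.commute)
  qed
  show ?thesis
    unfolding adjoint_unique[OF rep] using rep by metis
qed

lemma linear_adjoint_real_inner:
  fixes f :: "'a::euclidean_space \<Rightarrow> 'b::real_inner"
  assumes "linear f"
  shows "linear (adjoint f)"
proof (rule linearI)
  show "adjoint f (y + z) = adjoint f y + adjoint f z" for y z
    by (rule vector_eq_ldot[THEN iffD1])
      (simp add: adjoint_works_real_inner[OF assms] inner_add_right)
  show "adjoint f (c *\<^sub>R y) = c *\<^sub>R adjoint f y" for c y
    by (rule vector_eq_ldot[THEN iffD1]) (simp add: adjoint_works_real_inner[OF assms])
qed

text \<open>Moving \<open>A\<close> across the inner product turns the inequalities that define one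
  set into those that define the other.\<close>

lemma antipolar_image_linear:
  fixes A :: "'a::euclidean_space \<Rightarrow> 'b::real_inner"
  assumes "linear A"
  shows "antipolar (A ` C) = adjoint A -` antipolar C"
proof -
  have "inner (adjoint A y) x = inner y (A x)" for x y
    using adjoint_works_real_inner[OF assms, of x y] by (simp only: inner_commute)
  then show ?thesis
    by (simp add: antipolar_def vimage_def)
qed

text \<open>Strict separation from the origin gives a functional with a positive lower bound
  \<open>b\<close>; dividing by \<open>b\<close> normalizes the bound to 1.\<close>

lemma antipolar_nonempty:
  fixes S :: "'a::euclidean_space set"
  assumes "convex S" and "0 \<notin> closure S"
  shows "antipolar S \<noteq> {}"
proof -
  obtain a b where "0 < b" and sep: "\<forall>x\<in>closure S. inner a x > b"
    using separating_hyperplane_closed_0[OF convex_closure[OF assms(1)] closed_closure assms(2)]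
    by blast
  have "inner ((1 / b) *\<^sub>R a) x \<ge> 1" if "x \<in> S" for x
  proof -
    have "b < inner a x"
      using sep subsetD[OF closure_subset that] by (rule bspec)
    then show ?thesis
      using \<open>0 < b\<close> by (simp add: field_simps)
  qed
  then have "(1 / b) *\<^sub>R a \<in> antipolar S"
    by (simp add: antipolar_def)
  then show ?thesis
    by blast
qed

lemma norm_le_norm_adjoint_comp:
  fixes A :: "'a::euclidean_space \<Rightarrow> 'b::real_inner"
  assumes "linear A"
  obtains e where "e > 0" and "\<And>x. e * norm (A x) \<le> norm (adjoint A (A x))"
proof -
  interpret A: linear A by fact
  let ?M = "\<lambda>x. adjoint A (A x)"
  define K where "K = {x. A x = 0}"
  have inner_M: "inner x (?M y) = inner (A x) (A y)" for x y
    by (simp add: adjoint_works_real_inner[OF assms])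
  have "subspace K"
    unfolding K_def by (simp add: subspace_def A.zero A.add A.scale)
  have sub: "subspace (K\<^sup>\<bottom>)"
    by (rule subspace_orthogonal_comp)
  have "linear ?M"
    using linear_compose[OF assms linear_adjoint_real_inner[OF assms]] by (simp add: o_def)
  then have bl: "bounded_linear ?M"
    by (rule linear_conv_bounded_linear[THEN iffD1])
  \<comment> \<open>The inner product of \<open>x\<close> with \<open>?M x\<close> is the square of
    \<open>norm (A x)\<close>, so \<open>?M x = 0\<close> puts \<open>x\<close> in \<open>K\<close>;
    being also in \<open>K\<^sup>\<bottom>\<close>, it is orthogonal to itself.\<close>
  have inj: "\<forall>x\<in>K\<^sup>\<bottom>. ?M x = 0 \<longrightarrow> x = 0"
  proof (intro ballI impI)
    fix x assume x: "x \<in> K\<^sup>\<bottom>" and "?M x = 0"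
    then have "A x = 0"
      using inner_M[of x x] by simp
    then show "x = 0"
      using x by (auto simp: orthogonal_comp_def K_def orthogonal_def)
  qed
  obtain e where "e > 0" and e: "\<forall>x\<in>K\<^sup>\<bottom>. norm (?M x) \<ge> e * norm x"
    using injective_imp_isometric[OF closed_subspace[OF sub] sub bl inj] by auto
  \<comment> \<open>The square root arises because Cauchy-Schwarz bounds the square of
    \<open>norm (A z)\<close> by \<open>norm z * norm (?M z)\<close>, and \<open>norm z\<close> is
    at most \<open>norm (?M z) / e\<close>.\<close>
  have "sqrt e * norm (A x) \<le> norm (?M x)" for x
  proof -
    obtain y z where y: "y \<in> span K" and z: "\<And>w. w \<in> span K \<Longrightarrow> orthogonal z w"
      and x: "x = y + z"
      using orthogonal_subspace_decomp_exists[of K x] by metis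
    have "A y = 0"
      using y \<open>subspace K\<close> by (simp add: K_def span_eq_iff[THEN iffD2])
    then have Ax: "A x = A z"
      by (simp add: x A.add)
    have "z \<in> K\<^sup>\<bottom>"
      using z by (auto simp: orthogonal_comp_def orthogonal_commute span_base)
    with e have ez: "e * norm z \<le> norm (?M z)"
      by blast
    have "(sqrt e * norm (A z))\<^sup>2 = e * inner z (?M z)"
      using \<open>e > 0\<close> by (simp add: power_mult_distrib inner_M power2_norm_eq_inner)
    also have "\<dots> \<le> e * (norm z * norm (?M z))"
      using \<open>e > 0\<close> norm_cauchy_schwarz[of z "?M z"] by simp
    also have "\<dots> \<le> (norm (?M z))\<^sup>2"
      using mult_right_mono[OF ez norm_ge_zero[of "?M z"]]
      by (simp add: power2_eq_square mult.assoc)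
    finally show ?thesis
      unfolding Ax by (rule power2_le_imp_le) simp
  qed
  with \<open>e > 0\<close> show ?thesis
    by (intro that[of "sqrt e"]) auto
qed

lemma antipolar_image_nonempty:
  fixes A :: "'a::euclidean_space \<Rightarrow> 'b::real_inner"
  assumes "linear A" and "convex C" and "0 \<notin> closure (A ` C)"
  shows "antipolar (A ` C) \<noteq> {}"
proof -
  let ?M = "\<lambda>x. adjoint A (A x)"
  \<comment> \<open>\<open>d\<close> is the radius of a ball about the origin that misses
    \<open>A\<close> C\<open>; the ball of radius\<close>e * d\<open>will then miss\<close>?M
    \<open>C\<close>.\<close>
  obtain d where "d > 0" and d: "\<And>x. x \<in> C \<Longrightarrow> norm (A x) \<ge> d"
    using assms(3) by (auto simp: closure_approachable not_less)
  obtain e where "e > 0" and e: "\<And>x. e * norm (A x) \<le> norm (?M x)"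
    using norm_le_norm_adjoint_comp[OF assms(1)] by metis
  have "e * d \<le> norm (?M x)" if "x \<in> C" for x
    using mult_left_mono[OF d[OF that], of e] e[of x] \<open>e > 0\<close> by linarith
  then have "0 \<notin> closure (?M ` C)"
    using mult_pos_pos[OF \<open>e > 0\<close> \<open>d > 0\<close>]
    unfolding closure_approachable by (force simp: not_less)
  moreover have "convex (?M ` C)"
    using convex_linear_image[OF linear_compose[OF assms(1) linear_adjoint_real_inner[OF assms(1)]] assms(2)]
    by (simp add: o_def)
  ultimately obtain w where "w \<in> antipolar (?M ` C)"
    using antipolar_nonempty by blast
  \<comment> \<open>The inner product of \<open>A w\<close> with \<open>A x\<close> equals that of
    \<open>w\<close> with \<open>?M x\<close>.\<close>
  then have "A w \<in> antipolar (A ` C)"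
    by (simp add: antipolar_def adjoint_works_real_inner[OF assms(1)])
  then show ?thesis
    by blast
qed

theorem proposition3p3:
  fixes C :: "'a::euclidean_space set"
    and A :: "'a \<Rightarrow> 'b::real_inner"
  assumes "finite_dim_space TYPE('b)"
    and "C \<noteq> {}" and "closed C" and "convex C" and "0 \<notin> C"
    and "linear A"
  shows "antipolar (A ` C) = adjoint A -` antipolar C
    \<and> (0 \<notin> closure (A ` C) \<longrightarrow>
        antipolar (A ` C) \<noteq> {} \<and> adjoint A -` antipolar C \<noteq> {})"
  \<comment> \<open>The set equality passes nonemptiness on to the preimage.\<close>
  using antipolar_image_linear[OF \<open>linear A\<close>, of C]
    antipolar_image_nonempty[OF \<open>linear A\<close> \<open>convex C\<close>]
  by simp

end
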